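(* Let $\lambda$ be a monadic stream GSOS specification over a signature $\Sigma$ and output set $A$, and let $\mathcal V$ be a set of variables. For all $t_1,t_2\in T\mathcal V$: $[\![t_1]\!]_o=[\![t_2]\!]_o$ if and only if for all $\psi:\mathcal V\to A^\omega$, $[\![(T\psi)(t_1)]\!]_a=[\![(T\psi)(t_2)]\!]_a$.
   Context: A signature $\Sigma$ is a set of operation symbols with finite arities; $TX$ is the set of $\Sigma$-terms over $X$, and for $g:X\to Y$, $Tg:TX\to TY$ replaces each leaf $x$ by $g(x)$. A monadic stream GSOS specification for $\Sigma$ and a set $A$ is a set of rules $\frac{x_1\xrightarrow{a_1}x_1'\cdots x_n\xrightarrow{a_n}x_n'}{f(x_1,\dots,x_n)\xrightarrow{a}t}$ ($f$ of arity $n$, pairwise distinct variables, $t$ a $\Sigma$-term over $\{x_1',\dots,x_n'\}$ only) such that for each $f$ and each $(a_1,\dots,a_n)\in A^n$ exactly one rule for $f$ has premise labels $(a_1,\dots,a_n)$. Given a stream system $X\to A\times X$ (write $x\xrightarrow{a}y$), the specification extends it to $TX$: leaves behave as in $X$, and $f(s_1,\dots,s_n)\xrightarrow{a}t[s_1'/x_1',\dots,s_n'/x_n']$ when $s_i\xrightarrow{a_i}s_i'$ and the rule for $f$ with premise labels $(a_1,\dots,a_n)$ has conclusion $f(\vec x)\xrightarrow{a}t$. The abstract semantics $[\![u]\!]_a\in A^\omega$ of $u\in T(A^\omega)$ is the stream generated by $u$ when this extension is applied to the stream system on $A^\omega$ given by $\alpha\xrightarrow{\alpha(0)}\alpha'$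 where $\alpha'$ is the tail of $\alpha$. Open semantics: the Mealy machine $m_\lambda$ on $T\mathcal V$ has inputs $\varsigma:\mathcal V\to A$ and outputs in $A$; for a variable $\mathcal X$, $\mathcal X\xrightarrow{\varsigma\mid\varsigma(\mathcal X)}\mathcal X$, and $f(t_1,\dots,t_n)\xrightarrow{\varsigma\mid a}t[t_1'/x_1',\dots,t_n'/x_n']$ whenever $t_i\xrightarrow{\varsigma\mid a_i}t_i'$ for all $i$ and the rule for $f$ with premise labels $(a_1,\dots,a_n)$ has conclusion $f(\vec x)\xrightarrow{a}t$. For $t\in T\mathcal V$, $[\![t]\!]_o$ is the function $(A^\omega)^{\mathcal V}\to A^\omega$ with $[\![t]\!]_o(\psi)=a_0a_1a_2\cdots$ where $t_0=t$, $t_k\xrightarrow{\varsigma_k\mid a_k}t_{k+1}$ and $\varsigma_k(\mathcal X)=\psi(\mathcal X)(k)$. (Equivalently, $[\![t_1]\!]_o=[\![t_2]\!]_o$ iff $t_1,t_2$ are bisimilar states of the Mealy machine $m_\lambda$.) *)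

theory Defs
  imports Main "HOL-Library.Stream" "HOL-Library.FuncSet"
begin

text \<open>
  A signature is given by a set \<open>S\<close> of operation symbols and an arity function \<open>ar\<close>, which is
  relevant on \<open>S\<close> only. The map function \<open>tmap\<close> generated for the datatype of raw terms is the
  action of the term functor on functions.
\<close>

datatype (dead 'f, vars: 'x) trm = Var 'x | Op 'f "('f, 'x) trm list"
  for map: tmap

inductive_set terms :: "'f set \<Rightarrow> ('f \<Rightarrow> nat) \<Rightarrow> 'x set \<Rightarrow> ('f, 'x) trm set"
  for S :: "'f set" and ar :: "'f \<Rightarrow> nat" and X :: "'x set"
where
  Var: "x \<in> X \<Longrightarrow> Var x \<in> terms S ar X"
| Op: "\<lbrakk>f \<in> S; length ts = ar f; ts \<in> lists (terms S ar X)\<rbrakk> \<Longrightarrow> Op f ts \<in> terms S ar X"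

primrec subst :: "('x \<Rightarrow> ('f, 'y) trm) \<Rightarrow> ('f, 'x) trm \<Rightarrow> ('f, 'y) trm" where
  "subst \<sigma> (Var x) = \<sigma> x"
| "subst \<sigma> (Op f ts) = Op f (map (subst \<sigma>) ts)"

text \<open>
  \<open>Rule f [a\<^sub>1, \<dots>, a\<^sub>n] a t\<close> is the rule with premises \<open>x\<^sub>i \<rightarrow> x\<^sub>i'\<close> labelled \<open>a\<^sub>i\<close> and with
  conclusion \<open>f(x\<^sub>1, \<dots>, x\<^sub>n) \<rightarrow> t\<close> labelled \<open>a\<close>. Rules are taken up to renaming of their
  variables: the variable \<open>x\<^sub>i'\<close> is represented by \<open>i - 1\<close>, and the \<open>x\<^sub>i\<close> do not occur in \<open>t\<close>.
\<close>

datatype ('f, 'a) rule =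
  Rule (rule_op: 'f) (in_labels: "'a list") (out_label: 'a) (target: "('f, nat) trm")

definition monadic_gsos :: "'f set \<Rightarrow> ('f \<Rightarrow> nat) \<Rightarrow> 'a set \<Rightarrow> ('f, 'a) rule set \<Rightarrow> bool" where
  "monadic_gsos S ar A R \<longleftrightarrow>
    (\<forall>r\<in>R. rule_op r \<in> S \<and> length (in_labels r) = ar (rule_op r) \<and> in_labels r \<in> lists A \<and>
           out_label r \<in> A \<and> target r \<in> terms S ar {..<ar (rule_op r)}) \<and>
    (\<forall>f\<in>S. \<forall>as\<in>lists A. length as = ar f \<longrightarrow> (\<exists>!r. r \<in> R \<and> rule_op r = f \<and> in_labels r = as))"

text \<open>
  The transition of \<open>f(s\<^sub>1, \<dots>, s\<^sub>n)\<close> determined by \<open>R\<close>, given the list of the labels and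
  successors of the \<open>s\<^sub>i\<close>.
\<close>

definition fire :: "('f, 'a) rule set \<Rightarrow> 'f \<Rightarrow> ('a \<times> ('f, 'x) trm) list \<Rightarrow> 'a \<times> ('f, 'x) trm" where
  "fire R f ps =
    (let r = (THE r. r \<in> R \<and> rule_op r = f \<and> in_labels r = map fst ps)
     in (out_label r, subst (\<lambda>i. snd (ps ! i)) (target r)))"

primrec extend ::
  "('f, 'a) rule set \<Rightarrow> ('x \<Rightarrow> 'a \<times> 'x) \<Rightarrow> ('f, 'x) trm \<Rightarrow> 'a \<times> ('f, 'x) trm" where
  "extend R d (Var x) = (fst (d x), Var (snd (d x)))"
| "extend R d (Op f ss) = fire R f (map (extend R d) ss)"

primcorec generated :: "('s \<Rightarrow> 'a \<times> 's) \<Rightarrow> 's \<Rightarrow> 'a stream" where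
  "shd (generated c s) = fst (c s)"
| "stl (generated c s) = generated c (snd (c s))"

definition abstract_sem :: "('f, 'a) rule set \<Rightarrow> ('f, 'a stream) trm \<Rightarrow> 'a stream" where
  "abstract_sem R u = generated (extend R (\<lambda>\<alpha>. (shd \<alpha>, stl \<alpha>))) u"

primrec mealy :: "('f, 'a) rule set \<Rightarrow> ('v \<Rightarrow> 'a) \<Rightarrow> ('f, 'v) trm \<Rightarrow> 'a \<times> ('f, 'v) trm" where
  "mealy R inp (Var x) = (inp x, Var x)"
| "mealy R inp (Op f ts) = fire R f (map (mealy R inp) ts)"

primrec run :: "('f, 'a) rule set \<Rightarrow> ('v \<Rightarrow> 'a stream) \<Rightarrow> ('f, 'v) trm \<Rightarrow> nat \<Rightarrow> ('f, 'v) trm" where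
  "run R \<psi> t 0 = t"
| "run R \<psi> t (Suc k) = snd (mealy R (\<lambda>x. \<psi> x !! k) (run R \<psi> t k))"

text \<open>
  The elements of \<open>V \<rightarrow>\<^sub>E streams A\<close> represent the functions from \<open>V\<close> to the streams over \<open>A\<close>.
  The restriction makes equality of open semantics equality of functions on this domain.
\<close>

definition open_sem ::
  "'a set \<Rightarrow> ('f, 'a) rule set \<Rightarrow> 'v set \<Rightarrow> ('f, 'v) trm \<Rightarrow> ('v \<Rightarrow> 'a stream) \<Rightarrow> 'a stream" where
  "open_sem A R V t =
    (\<lambda>\<psi> \<in> V \<rightarrow>\<^sub>E streams A. smap (\<lambda>k. fst (mealy R (\<lambda>x. \<psi> x !! k) (run R \<psi> t k))) nats)"

end

theory Submission imports Defs
begin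

text \<open>
  The assignment \<open>\<psi>\<close> makes \<open>tmap \<psi>\<close> commute with transitions: the Mealy machine, fed with the heads of
  \<open>\<psi>\<close>, simulates the transition of \<open>tmap \<psi> t\<close>, whose target is the Mealy successor mapped along the
  tails of \<open>\<psi>\<close>. Iterating, the abstract semantics of \<open>tmap \<psi> t\<close> is the value of the open semantics
  of \<open>t\<close> at \<open>\<psi>\<close>.
\<close>

text \<open>Isolates the choice made inside \<open>fire\<close>: it depends on the operation symbol
  and the label list only, so two lists of transitions with the same labels fire the same
  rule.\<close>

definition rule_for :: "('f, 'a) rule set \<Rightarrow> 'f \<Rightarrow> 'a list \<Rightarrow> ('f, 'a) rule" where
  "rule_for R f as = (THE r. r \<in> R \<and> rule_op r = f \<and> in_labels r = as)"

lemma fire_rule_for: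
  "fire R f ps = (out_label (rule_for R f (map fst ps)),
    subst (\<lambda>i. snd (ps ! i)) (target (rule_for R f (map fst ps))))"
  by (simp add: fire_def rule_for_def Let_def)

lemma rule_for:
  assumes "monadic_gsos S ar A R" "f \<in> S" "length as = ar f" "as \<in> lists A"
  shows "out_label (rule_for R f as) \<in> A" "target (rule_for R f as) \<in> terms S ar {..<ar f}"
proof -
  have "\<exists>!r. r \<in> R \<and> rule_op r = f \<and> in_labels r = as"
    using assms unfolding monadic_gsos_def by blast
  from theI'[OF this]
  have "rule_for R f as \<in> R" "rule_op (rule_for R f as) = f"
    unfolding rule_for_def by simp_all
  then show "out_label (rule_for R f as) \<in> A" "target (rule_for R f as) \<in> terms S ar {..<ar f}"
    using assms(1) unfolding monadic_gsos_def by auto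
qed

lemma subst_terms:
  assumes "t \<in> terms S ar X" "\<And>x. x \<in> X \<Longrightarrow> \<sigma> x \<in> terms S ar Y"
  shows "subst \<sigma> t \<in> terms S ar Y"
  using assms by (induction t rule: terms.induct) (auto intro!: terms.Op)

lemma subst_cong_terms:
  assumes "t \<in> terms S ar X" "\<And>x. x \<in> X \<Longrightarrow> \<sigma> x = \<tau> x"
  shows "subst \<sigma> t = subst \<tau> t"
  using assms by (induction t rule: terms.induct) auto

lemma tmap_subst: "tmap g (subst \<sigma> t) = subst (\<lambda>x. tmap g (\<sigma> x)) t"
  by (induction t) auto

text \<open>A specification fixes a unique rule only when the premise labels lie in
  \<open>A\<close>. This invariant keeps the \<open>THE\<close> in \<open>fire\<close> well defined
  and keeps runs inside the terms over \<open>V\<close>.\<close>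

lemma mealy_terms:
  assumes "monadic_gsos S ar A R" "t \<in> terms S ar V" "\<And>x. x \<in> V \<Longrightarrow> inp x \<in> A"
  shows "mealy R inp t \<in> A \<times> terms S ar V"
  using assms(2)
proof (induction t rule: terms.induct)
  case (Var x)
  then show ?case using assms(3) by (auto intro: terms.Var)
next
  case (Op f ts)
  let ?ps = "map (mealy R inp) ts"
  have ps: "mealy R inp s \<in> A \<times> terms S ar V" if "s \<in> set ts" for s
    using Op.hyps Op.IH that by auto
  let ?r = "rule_for R f (map fst ?ps)"
  have "map fst ?ps \<in> lists A" using ps by force
  then have "out_label ?r \<in> A" and tgt: "target ?r \<in> terms S ar {..<ar f}"
    using Op.hyps(2) by (intro rule_for[OF assms(1) Op.hyps(1)]; simp)+
  moreover have "subst (\<lambda>i. snd (?ps ! i)) (target ?r) \<in> terms S ar V"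
    using tgt
  proof (rule subst_terms)
    fix i assume "i \<in> {..<ar f}"
    then have "mealy R inp (ts ! i) \<in> A \<times> terms S ar V" and "i < length ts"
      using Op.hyps(2) by (auto intro: ps)
    then show "snd (?ps ! i) \<in> terms S ar V" by auto
  qed
  ultimately show ?case
    by (simp only: mealy.simps fire_rule_for mem_Times_iff fst_conv snd_conv)
qed

text \<open>Equal labels select the same rule on both sides, and by \<open>tmap_subst\<close> its
  instantiated target commutes with the renaming of leaves. Two maps \<open>\<psi>\<close> and
  \<open>\<psi>'\<close> occur because the Mealy machine keeps a variable in place while the state
  that it stands for moves on.\<close>

lemma extend_tmap:
  assumes "monadic_gsos S ar A R" "t \<in> terms S ar V" "\<And>x. x \<in> V \<Longrightarrow> inp x \<in> A"
    and "\<And>x. d (\<psi> x) = (inp x, \<psi>' x)"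
  shows "extend R d (tmap \<psi> t) = map_prod id (tmap \<psi>') (mealy R inp t)"
  using assms(2)
proof (induction t rule: terms.induct)
  case (Var x)
  then show ?case by (simp add: assms(4))
next
  case (Op f ts)
  let ?ps = "map (mealy R inp) ts"
  let ?qs = "map (map_prod id (tmap \<psi>')) ?ps"
  let ?r = "rule_for R f (map fst ?ps)"
  have "mealy R inp s \<in> A \<times> terms S ar V" if "s \<in> set ts" for s
    using Op.hyps Op.IH that by (intro mealy_terms[OF assms(1) _ assms(3)]) auto
  then have "map fst ?ps \<in> lists A" by force
  then have tgt: "target ?r \<in> terms S ar {..<ar f}"
    using Op.hyps(2) by (intro rule_for[OF assms(1) Op.hyps(1)]) simp_all
  \<comment> \<open>Pulling \<open>map\<close> out of \<open>nth\<close> requires an index in range.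
    The variables of the target lie below \<open>ar f\<close>, the length of \<open>ts\<close>, so
    no other index matters.\<close>
  have "subst (\<lambda>i. snd (?qs ! i)) (target ?r) = tmap \<psi>' (subst (\<lambda>i. snd (?ps ! i)) (target ?r))"
    unfolding tmap_subst using tgt by (rule subst_cong_terms) (simp add: Op.hyps(2))
  moreover have "map fst ?qs = map fst ?ps" by simp
  ultimately have "fire R f ?qs = map_prod id (tmap \<psi>') (fire R f ?ps)"
    by (simp only: fire_rule_for map_prod_simp id_apply)
  moreover have "map (extend R d) (map (tmap \<psi>) ts) = ?qs"
    using Op.IH by (auto simp del: map_prod_simp simp: id_def)
  ultimately show ?case by (simp only: trm.map extend.simps mealy.simps)
qed

lemma run_terms:
  assumes "monadic_gsos S ar A R" "t \<in> terms S ar V" "\<And>x. x \<in> V \<Longrightarrow> \<psi> x \<in> streams A"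
  shows "run R \<psi> t k \<in> terms S ar V"
proof (induction k)
  case (Suc k)
  show ?case
    using mealy_terms[OF assms(1) Suc snth_in[OF assms(3)]] by (auto simp: mem_Times_iff)
qed (simp add: assms(2))

lemma abstract_sem_snth:
  assumes "monadic_gsos S ar A R" "t \<in> terms S ar V" "\<And>x. x \<in> V \<Longrightarrow> \<psi> x \<in> streams A"
  shows "abstract_sem R (tmap \<psi> t) !! k = fst (mealy R (\<lambda>x. \<psi> x !! k) (run R \<psi> t k))"
proof -
  let ?c = "extend R (\<lambda>\<alpha>. (shd \<alpha>, stl \<alpha>))"
  \<comment> \<open>After \<open>k\<close> steps the leaf at \<open>x\<close> is the
    \<open>k\<close>-th tail of \<open>\<psi> x\<close>, and its head \<open>\<psi> x !! k\<close>
    is exactly the \<open>k\<close>-th input of the Mealy machine.\<close>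
  have step: "?c (tmap (\<lambda>x. sdrop k (\<psi> x)) (run R \<psi> t k)) =
      map_prod id (tmap (\<lambda>x. sdrop (Suc k) (\<psi> x))) (mealy R (\<lambda>x. \<psi> x !! k) (run R \<psi> t k))" for k
    by (rule extend_tmap[OF assms(1) run_terms[OF assms] snth_in[OF assms(3)]]) simp_all
  \<comment> \<open>The induction tracks whole tails, since it needs the state reached after
    \<open>k\<close> steps; the \<open>k\<close>-th entry alone does not determine the next
    one.\<close>
  have "sdrop k (abstract_sem R (tmap \<psi> t)) =
      generated ?c (tmap (\<lambda>x. sdrop k (\<psi> x)) (run R \<psi> t k))" for k
  proof (induction k)
    case 0
    then show ?case by (simp add: abstract_sem_def)
  next
    case (Suc k)
    have "sdrop (Suc k) (abstract_sem R (tmap \<psi> t)) = stl (sdrop k (abstract_sem R (tmap \<psi> t)))"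
      by simp
    also have "\<dots> = generated ?c (tmap (\<lambda>x. sdrop (Suc k) (\<psi> x)) (run R \<psi> t (Suc k)))"
      unfolding Suc generated.simps step by simp
    finally show ?case .
  qed
  then have "shd (sdrop k (abstract_sem R (tmap \<psi> t))) =
      fst (mealy R (\<lambda>x. \<psi> x !! k) (run R \<psi> t k))"
    by (simp only: generated.simps step) simp
  then show ?thesis by simp
qed

lemma open_sem_eq_abstract_sem:
  assumes "monadic_gsos S ar A R" "t \<in> terms S ar V"
  shows "open_sem A R V t = (\<lambda>\<psi> \<in> V \<rightarrow>\<^sub>E streams A. abstract_sem R (tmap \<psi> t))"
  unfolding open_sem_def
proof (rule restrict_ext)
  fix \<psi> assume "\<psi> \<in> V \<rightarrow>\<^sub>E streams A"
  then have "\<And>x. x \<in> V \<Longrightarrow> \<psi> x \<in> streams A" by auto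
  \<comment> \<open>Entrywise equality suffices: \<open>smap_alt\<close> reduces the goal to it, and
    entry \<open>k\<close> of \<open>nats\<close> is \<open>k\<close>.\<close>
  from abstract_sem_snth[OF assms this]
  show "smap (\<lambda>k. fst (mealy R (\<lambda>x. \<psi> x !! k) (run R \<psi> t k))) nats = abstract_sem R (tmap \<psi> t)"
    by (simp add: smap_alt)
qed

theorem theorem3:
  fixes S :: "'f set" and ar :: "'f \<Rightarrow> nat" and A :: "'a set"
    and R :: "('f, 'a) rule set" and V :: "'v set" and t\<^sub>1 t\<^sub>2 :: "('f, 'v) trm"
  assumes "monadic_gsos S ar A R"
    and "t\<^sub>1 \<in> terms S ar V" and "t\<^sub>2 \<in> terms S ar V"
  shows "open_sem A R V t\<^sub>1 = open_sem A R V t\<^sub>2 \<longleftrightarrow>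
    (\<forall>\<psi> \<in> V \<rightarrow>\<^sub>E streams A. abstract_sem R (tmap \<psi> t\<^sub>1) = abstract_sem R (tmap \<psi> t\<^sub>2))"
  unfolding open_sem_eq_abstract_sem[OF assms(1,2)] open_sem_eq_abstract_sem[OF assms(1,3)]
\<comment> \<open>Both open semantics are now restrictions to the same set, so they are equal
  exactly when they agree at each of its points.\<close>
proof
  assume eq: "(\<lambda>\<psi> \<in> V \<rightarrow>\<^sub>E streams A. abstract_sem R (tmap \<psi> t\<^sub>1)) =
    (\<lambda>\<psi> \<in> V \<rightarrow>\<^sub>E streams A. abstract_sem R (tmap \<psi> t\<^sub>2))"
  show "\<forall>\<psi> \<in> V \<rightarrow>\<^sub>E streams A. abstract_sem R (tmap \<psi> t\<^sub>1) = abstract_sem R (tmap \<psi> t\<^sub>2)"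
  proof
    fix \<psi> assume "\<psi> \<in> V \<rightarrow>\<^sub>E streams A"
    with fun_cong[OF eq, of \<psi>] show "abstract_sem R (tmap \<psi> t\<^sub>1) = abstract_sem R (tmap \<psi> t\<^sub>2)"
      by (simp only: restrict_apply')
  qed
qed (auto intro: restrict_ext)

end
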